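(* Let $\tilde W_S>0$, $\tilde E_B\ge 0$, $L/\xi\ge 1$, $\kappa\in(0,1)$, let $\theta$ be any nonconstant solution of the boundary value problem (BVP) given in the context, and set $p_x(x)=\cos\theta(x)$. Then: 1. $\theta'(x)>0$ for every $x\in[0,1]$. 2. If $\tilde E_B=0$, then $\cos\theta(x)=-\cos\theta(1-x)$ for every $x\in[0,1]$. In particular, $\cos\theta(1/2)=0$ and $\cos\theta(x)\ne0$ for every $x\neq\frac12$. If (still with $\tilde E_B=0$) $\theta_1$ and $\theta_2$ are two nonconstant solutions of (BVP) such that, for $i=1,2$, $$\frac{\tilde W_S^2\sin^2\theta_i(x)}{\sin^2\theta_i(x)+\kappa\cos^2\theta_i(x)}-\left(\cos^2\theta_i(x)-2\tilde E_B\cos\theta_i(x)\right)=C_i\quad\text{at }x=0,1,$$ with constants $C_1>C_2$, then $\cos^2\theta_1(x)>\cos^2\theta_2(x)$ for all $x\in[0,1]\setminus\{\frac12\}$. 3. If $\tilde E_B\ge\max\left\{1,\ \tilde W_S^2\,\frac{\sqrt{\kappa+2+\sqrt{\kappa^2+8\kappa}}}{2\sqrt2}\right\}$, then $p_x''<0$ on $[0,1]$. 4. If $p_x(0)\ge\tilde E_B$ and $p_x(1)\le0$, then there exists a unique $x_0\in(0,1)$ such that $\theta''(x_0)=0$. Moreover, $\theta''(x)>0$ for $x\in(x_0,1)$ and $\theta''(x)<0$ for $x\in(0,x_0)$.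
   Context: Parameters: $\tilde W_S$ (surface anchoring strength), $\tilde E_B$ (bias field), $L/\xi$ (ratio of cell thickness to correlation length), $\kappa$ (bend-to-splay ratio) are real numbers with $\tilde W_S>0$, $\tilde E_B\ge0$, $L/\xi\ge1$, $\kappa\in(0,1)$. (BVP): the Euler-Lagrange equation $$(\sin^2\theta+\kappa\cos^2\theta)\theta''+\tfrac12(1-\kappa)\sin 2\theta\,(\theta')^2+\tfrac12\left(\tfrac{L}{\xi}\right)^2\sin2\theta-\tilde E_B\left(\tfrac L\xi\right)^2\sin\theta=0\quad\text{on }(0,1)$$ with the nonlinear boundary conditions $$-\tilde W_S\left(\tfrac L\xi\right)\sin\theta+(\sin^2\theta+\kappa\cos^2\theta)\theta'=0\quad\text{at }x=0\text{ and }x=1.$$ A solution is a (smooth) function $\theta:[0,1]\to[0,\pi]$ satisfying the equation and both boundary conditions. *)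

theory Defs
  imports "HOL-Analysis.Analysis"
begin

(* A function on [0,1] is represented by a total function on the reals of which only the
   values on [0,1] matter: "at x within {0..1}" makes this the ordinary derivative
   on (0,1) and the one-sided derivative at 0 and at 1. *)
definition deriv01 :: "(real \<Rightarrow> real) \<Rightarrow> real \<Rightarrow> real" where
  "deriv01 f x = vector_derivative f (at x within {0..1})"

(* C^infinity on the closed interval [0,1] *)
definition smooth01 :: "(real \<Rightarrow> real) \<Rightarrow> bool" where
  "smooth01 f \<longleftrightarrow> (\<forall>n. (deriv01 ^^ n) f differentiable_on {0..1})"

(* r stands for the ratio L/xi. *)
definition euler_lagrange ::
  "real \<Rightarrow> real \<Rightarrow> real \<Rightarrow> (real \<Rightarrow> real) \<Rightarrow> real \<Rightarrow> bool" where
  "euler_lagrange E r \<kappa> \<theta> x \<longleftrightarrow>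
     ((sin (\<theta> x))\<^sup>2 + \<kappa> * (cos (\<theta> x))\<^sup>2) * deriv01 (deriv01 \<theta>) x
     + (1 / 2) * (1 - \<kappa>) * sin (2 * \<theta> x) * (deriv01 \<theta> x)\<^sup>2
     + (1 / 2) * r\<^sup>2 * sin (2 * \<theta> x)
     - E * r\<^sup>2 * sin (\<theta> x) = 0"

definition boundary_condition ::
  "real \<Rightarrow> real \<Rightarrow> real \<Rightarrow> (real \<Rightarrow> real) \<Rightarrow> real \<Rightarrow> bool" where
  "boundary_condition W r \<kappa> \<theta> x \<longleftrightarrow>
     - W * r * sin (\<theta> x)
     + ((sin (\<theta> x))\<^sup>2 + \<kappa> * (cos (\<theta> x))\<^sup>2) * deriv01 \<theta> x = 0"

definition bvp_solution ::
  "real \<Rightarrow> real \<Rightarrow> real \<Rightarrow> real \<Rightarrow> (real \<Rightarrow> real) \<Rightarrow> bool" where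
  "bvp_solution W E r \<kappa> \<theta> \<longleftrightarrow>
     smooth01 \<theta> \<and> \<theta> \<in> {0..1} \<rightarrow> {0..pi} \<and>
     (\<forall>x\<in>{0<..<1}. euler_lagrange E r \<kappa> \<theta> x) \<and>
     boundary_condition W r \<kappa> \<theta> 0 \<and> boundary_condition W r \<kappa> \<theta> 1"

end

(* Write c = cos \<theta> and g = sin\<^sup>2 \<theta> + \<kappa> cos\<^sup>2 \<theta> = 1 - (1 - \<kappa>) c\<^sup>2. The equation has the first integral
   g \<theta>'\<^sup>2 = r\<^sup>2 (C + c\<^sup>2 - 2 E c). If \<theta>' vanished somewhere, then \<theta>' > 0 at both ends would give a
   first zero with c > E and a last zero with c < E; at a point between them with c = E the first
   integral is negative. With \<theta>' > 0, equating the two boundary values of C and dividing by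
   c(0) - c(1) gives (c(0) + c(1)) (1 + W\<^sup>2 \<kappa> / (g(0) g(1))) = 2 E. For E = 0 this says that \<theta> and its
   reflection start at the same point, so they agree by uniqueness for the first-order equation
   defined by the first integral, and two solutions are compared through the same equation. For E
   large the relation bounds \<theta>'\<^sup>2 well enough to give p'' < 0. Finally, the sign of \<theta>'' is opposite
   to that of a concave quadratic polynomial in c. *)

theory Submission
  imports Defs
begin

section \<open>Zeros of differentiable functions on an interval\<close>

text \<open>The infimum of the closed set where \<open>f\<close> is nonpositive is a zero by the
  intermediate value theorem. Since \<open>f\<close> is positive to its left, the derivative there
  cannot be positive.\<close>

lemma first_zero:
  fixes f :: "real \<Rightarrow> real"
  assumes deriv: "\<And>x. x \<in> {a..b} \<Longrightarrow> (f has_real_derivative f' x) (at x within {a..b})"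
    and "f a > 0" and y: "y \<in> {a..b}" "f y \<le> 0"
  obtains z where "z \<in> {a<..b}" "f z = 0" "f' z \<le> 0"
proof -
  have cont: "continuous_on {a..b} f"
    by (rule DERIV_continuous_on[OF deriv])
  define Z where "Z = {x \<in> {a..b}. f x \<le> 0}"
  have "Z = {a..b} \<inter> f -` {..0}"
    by (auto simp: Z_def)
  then have "closed Z"
    using continuous_closed_preimage[OF cont, of "{..0}"] by simp
  moreover have "Z \<noteq> {}" "bdd_below Z"
    using y by (auto simp: Z_def intro: bdd_belowI[of _ a])
  ultimately have "Inf Z \<in> Z" and Inf_le: "\<And>x. x \<in> Z \<Longrightarrow> Inf Z \<le> x"
    by (auto intro: closed_contains_Inf cInf_lower)
  define z where "z = Inf Z"
  have z: "z \<in> {a..b}" "f z \<le> 0"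
    using \<open>Inf Z \<in> Z\<close> by (auto simp: Z_def z_def)
  have pos: "f x > 0" if "a \<le> x" "x < z" for x
    using Inf_le[of x] that z by (force simp: Z_def z_def)
  have "a < z"
    using z \<open>f a > 0\<close> by (cases "z = a") auto
  have "f z = 0"
  proof (rule ccontr)
    assume "f z \<noteq> 0"
    with z have "f z < 0" by simp
    then obtain x where "a \<le> x" "x \<le> z" "f x = 0"
      using IVT2'[of f z 0 a] \<open>f a > 0\<close> \<open>a < z\<close> z continuous_on_subset[OF cont, of "{a..z}"]
      by auto
    with pos[of x] \<open>f z < 0\<close> show False by force
  qed
  moreover have "f' z \<le> 0"
  proof (rule ccontr)
    assume "\<not> f' z \<le> 0"
    then obtain d where d: "d > 0" "\<And>h. h > 0 \<Longrightarrow> z - h \<in> {a..b} \<Longrightarrow> h < d \<Longrightarrow> f (z - h) < f z"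
      using has_real_derivative_pos_inc_left[OF deriv[OF z(1)]] by auto
    \<comment> \<open>This keeps \<open>z - h\<close> in \<open>{a..<z}\<close>, where
      \<open>f\<close> is still positive.\<close>
    define h where "h = min (d / 2) (z - a)"
    have "f (z - h) < f z"
      using \<open>a < z\<close> z d(1) by (intro d(2)) (auto simp: h_def)
    moreover have "f (z - h) > 0"
      using \<open>a < z\<close> d(1) by (intro pos) (auto simp: h_def)
    ultimately show False using \<open>f z = 0\<close> by simp
  qed
  ultimately show ?thesis
    using that \<open>a < z\<close> z by auto
qed

text \<open>\<open>first_zero\<close> applies to \<open>f (- x)\<close>, and the chain rule flips
  the sign of the derivative.\<close>

lemma last_zero:
  fixes f :: "real \<Rightarrow> real"
  assumes deriv: "\<And>x. x \<in> {a..b} \<Longrightarrow> (f has_real_derivative f' x) (at x within {a..b})"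
    and "f b > 0" and y: "y \<in> {a..b}" "f y \<le> 0"
  obtains z where "z \<in> {a..<b}" "f z = 0" "f' z \<ge> 0"
proof -
  have "((\<lambda>x. f (- x)) has_real_derivative - f' (- x)) (at x within {-b..-a})"
    if "x \<in> {-b..-a}" for x
  proof -
    have "(f has_real_derivative f' (- x)) (at (- x) within uminus ` {-b..-a})"
      using deriv[of "- x"] that by simp
    then have "(f \<circ> uminus has_real_derivative f' (- x) * -1) (at x within {-b..-a})"
      by (rule DERIV_image_chain) (auto intro!: derivative_eq_intros)
    then show ?thesis by (simp add: o_def)
  qed
  then obtain z where "z \<in> {-b<..-a}" "f (- z) = 0" "- f' (- z) \<le> 0"
    by (rule first_zero[where y = "- y"]) (use assms in auto)
  then show ?thesis
    using that[of "- z"] by auto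
qed

text \<open>Just to the right of \<open>a\<close> the function is positive, and its first return to
  zero would have a nonpositive derivative. This serves to compare two solutions that agree at one
  point.\<close>

lemma positive_if_increasing_at_zeros:
  fixes f :: "real \<Rightarrow> real"
  assumes deriv: "\<And>x. x \<in> {a..b} \<Longrightarrow> (f has_real_derivative f' x) (at x within {a..b})"
    and zero: "\<And>x. x \<in> {a..b} \<Longrightarrow> f x = 0 \<Longrightarrow> f' x > 0"
    and "f a = 0" and x: "x \<in> {a<..b}"
  shows "f x > 0"
proof (rule ccontr)
  assume "\<not> f x > 0"
  obtain d where d: "d > 0" "\<And>h. h > 0 \<Longrightarrow> a + h \<in> {a..b} \<Longrightarrow> h < d \<Longrightarrow> f a < f (a + h)"
    using has_real_derivative_pos_inc_right[OF deriv zero, of a] x \<open>f a = 0\<close> by auto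
  \<comment> \<open>Stopping at \<open>x\<close> keeps the supposed nonpositive point inside
    \<open>{y..b}\<close>.\<close>
  define y where "y = a + min (d / 2) (x - a)"
  have y: "a < y" "y \<le> x" "f y > 0"
    using d(2)[of "min (d / 2) (x - a)"] d(1) x \<open>f a = 0\<close> by (auto simp: y_def)
  have "(f has_real_derivative f' t) (at t within {y..b})" if "t \<in> {y..b}" for t
    using deriv[of t] y that by (auto intro: DERIV_subset)
  then obtain z where "z \<in> {y<..b}" "f z = 0" "f' z \<le> 0"
    by (rule first_zero[where y = x]) (use y x \<open>\<not> f x > 0\<close> in auto)
  with zero[of z] y show False by auto
qed

text \<open>Gronwall in both directions: \<open>w t * exp (- K * t)\<close> is nonincreasing and
  \<open>w t * exp (K * t)\<close> is nondecreasing, so a zero at \<open>z\<close> forces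
  \<open>w \<le> 0\<close> on both sides of it.\<close>

lemma gronwall_nonneg_zero:
  fixes w :: "real \<Rightarrow> real"
  assumes deriv: "\<And>x. x \<in> {a..b} \<Longrightarrow> (w has_real_derivative w' x) (at x within {a..b})"
    and bound: "\<And>x. x \<in> {a..b} \<Longrightarrow> \<bar>w' x\<bar> \<le> K * w x"
    and nonneg: "\<And>x. x \<in> {a..b} \<Longrightarrow> w x \<ge> 0"
    and z: "z \<in> {a..b}" "w z = 0" and x: "x \<in> {a..b}"
  shows "w x = 0"
proof -
  define v where "v s t = w t * exp (s * K * t)" for s t :: real
  have v: "(v s has_real_derivative (w' t + s * K * w t) * exp (s * K * t)) (at t within {a..b})"
    if "t \<in> {a..b}" for s t
    unfolding v_def
    by (rule derivative_eq_intros deriv that | simp add: algebra_simps)+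
  have cont: "continuous_on {c..d} (v s)" if "a \<le> c" "d \<le> b" for s c d
    by (rule continuous_on_subset[OF DERIV_continuous_on[OF v]]) (use that in auto)
  have v_at: "(v s has_real_derivative (w' t + s * K * w t) * exp (s * K * t)) (at t)"
    if "a < t" "t < b" for s t
    using v[of t s] that by (simp add: at_within_Icc_at)
  have "v s x \<le> v s z" if s: "s = (if z \<le> x then -1 else 1)" for s
  proof (cases "z \<le> x")
    case True
    show ?thesis
    proof (rule DERIV_nonpos_imp_decreasing_open[OF True])
      fix t assume t: "z < t" "t < x"
      have "(w' t + s * K * w t) * exp (s * K * t) \<le> 0"
        using bound[of t] t z x s True by (auto intro!: mult_nonpos_nonneg)
      then show "\<exists>y. (v s has_real_derivative y) (at t) \<and> y \<le> 0"
        using v_at[of t s] t z x by auto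
    qed (use cont z x in auto)
  next
    case False
    show ?thesis
    proof (rule DERIV_nonneg_imp_increasing_open[of x z])
      fix t assume t: "x < t" "t < z"
      have "(w' t + s * K * w t) * exp (s * K * t) \<ge> 0"
        using bound[of t] t z x s False by (auto intro!: mult_nonneg_nonneg)
      then show "\<exists>y. (v s has_real_derivative y) (at t) \<and> y \<ge> 0"
        using v_at[of t s] t z x by auto
    qed (use False cont z x in auto)
  qed
  then have "w x * exp ((if z \<le> x then -1 else 1) * K * x) \<le> 0"
    using z(2) by (simp add: v_def)
  then have "w x \<le> 0"
    by (simp add: mult_le_0_iff)
  with nonneg[OF x] show ?thesis by simp
qed

text \<open>Passing to the square of \<open>f\<close> keeps differentiability, which the absolute
  value may lose, and doubles the constant. The lemma stands in for uniqueness of first-order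
  initial value problems.\<close>

lemma gronwall_zero:
  fixes f :: "real \<Rightarrow> real"
  assumes deriv: "\<And>x. x \<in> {a..b} \<Longrightarrow> (f has_real_derivative f' x) (at x within {a..b})"
    and bound: "\<And>x. x \<in> {a..b} \<Longrightarrow> \<bar>f' x\<bar> \<le> K * \<bar>f x\<bar>"
    and z: "z \<in> {a..b}" "f z = 0" and x: "x \<in> {a..b}"
  shows "f x = 0"
proof -
  have "(f x)\<^sup>2 = 0"
  proof (rule gronwall_nonneg_zero[where w = "\<lambda>x. (f x)\<^sup>2" and K = "2 * K", OF _ _ _ z(1) _ x])
    show "((\<lambda>x. (f x)\<^sup>2) has_real_derivative 2 * f x * f' x) (at x within {a..b})"
      if "x \<in> {a..b}" for x
      by (rule derivative_eq_intros deriv that refl | simp)+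
    show "\<bar>2 * f x * f' x\<bar> \<le> 2 * K * (f x)\<^sup>2" if "x \<in> {a..b}" for x
    proof -
      have "\<bar>2 * f x * f' x\<bar> = 2 * \<bar>f x\<bar> * \<bar>f' x\<bar>"
        by (simp add: abs_mult)
      also have "\<dots> \<le> 2 * \<bar>f x\<bar> * (K * \<bar>f x\<bar>)"
        using bound[OF that] by (rule mult_left_mono) simp
      also have "\<dots> = 2 * K * (f x)\<^sup>2"
        by (simp add: power2_eq_square)
      finally show ?thesis .
    qed
  qed (use z in auto)
  then show ?thesis by simp
qed

section \<open>Derivatives on the closed unit interval\<close>

lemma deriv01_has_real_derivative:
  assumes "f differentiable_on {0..1}" "x \<in> {0..1}"
  shows "(f has_real_derivative deriv01 f x) (at x within {0..1})"
  using assms unfolding deriv01_def has_real_derivative_iff_has_vector_derivative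
  by (auto simp: differentiable_on_def vector_derivative_works)

lemma deriv01_eqI:
  assumes "(f has_real_derivative d) (at x within {0..1})" "x \<in> {0..1}"
  shows "deriv01 f x = d"
  using assms unfolding deriv01_def has_real_derivative_iff_has_vector_derivative
  by (intro vector_derivative_within_closed_interval) auto

text \<open>A derivative within \<open>{0..1}\<close> sees only values there, so
  \<open>deriv01\<close> can be iterated on a derivative that is computed only on the
  interval.\<close>

lemma deriv01_cong:
  assumes "\<And>t. t \<in> {0..1} \<Longrightarrow> f t = g t" "x \<in> {0..1}"
  shows "deriv01 f x = deriv01 g x"
proof -
  have "(f has_vector_derivative d) (at x within {0..1}) \<longleftrightarrow>
      (g has_vector_derivative d) (at x within {0..1})" for d
    using assms has_vector_derivative_transform[of x "{0..1}"] by metis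
  then show ?thesis
    by (simp add: deriv01_def vector_derivative_def)
qed

lemma abs_cos_diff_le: "\<bar>cos x - cos y\<bar> \<le> \<bar>x - y\<bar>" for x y :: real
proof -
  have "norm (cos x - cos y) \<le> 1 * norm (x - y)"
    by (rule field_differentiable_bound[of UNIV cos "\<lambda>x. - sin x"])
      (auto intro!: derivative_eq_intros)
  then show ?thesis by simp
qed

section \<open>The elastic coefficient\<close>

definition coefg :: "real \<Rightarrow> real \<Rightarrow> real" where
  "coefg \<kappa> c = 1 - (1 - \<kappa>) * c\<^sup>2"

lemma coefg_cos: "(sin t)\<^sup>2 + \<kappa> * (cos t)\<^sup>2 = coefg \<kappa> (cos t)"
  by (simp add: coefg_def sin_squared_eq algebra_simps)

lemma coefg_ge:
  assumes "\<kappa> \<in> {0<..<1}" "c\<^sup>2 \<le> 1"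
  shows "\<kappa> \<le> coefg \<kappa> c"
  using mult_left_mono[OF assms(2), of "1 - \<kappa>"] assms(1) by (simp add: coefg_def algebra_simps)

text \<open>Over the common denominator the mixed terms cancel. The factor left in the numerator is
  what allows division by \<open>c 0 - c 1\<close> in the relation between the boundary
  values.\<close>

lemma coefg_ratio_diff:
  assumes "coefg \<kappa> a > 0" "coefg \<kappa> b > 0"
  shows "(1 - a\<^sup>2) / coefg \<kappa> a - (1 - b\<^sup>2) / coefg \<kappa> b
      = \<kappa> * (b\<^sup>2 - a\<^sup>2) / (coefg \<kappa> a * coefg \<kappa> b)"
proof -
  have "(1 - a\<^sup>2) / coefg \<kappa> a - (1 - b\<^sup>2) / coefg \<kappa> b
      = ((1 - a\<^sup>2) * coefg \<kappa> b - (1 - b\<^sup>2) * coefg \<kappa> a) / (coefg \<kappa> a * coefg \<kappa> b)"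
    using assms by (simp add: field_simps)
  also have "(1 - a\<^sup>2) * coefg \<kappa> b - (1 - b\<^sup>2) * coefg \<kappa> a = \<kappa> * (b\<^sup>2 - a\<^sup>2)"
    by (simp add: coefg_def algebra_simps)
  finally show ?thesis .
qed

lemma coefg_strict_antimono:
  assumes "\<kappa> \<in> {0<..<1}" "a\<^sup>2 < b\<^sup>2"
  shows "coefg \<kappa> b < coefg \<kappa> a"
  using mult_strict_left_mono[OF assms(2), of "1 - \<kappa>"] assms(1) by (simp add: coefg_def)

text \<open>
  Here \<open>b\<close> is \<open>cos \<theta>\<close> at \<open>0\<close> and \<open>-a\<close> is \<open>cos \<theta>\<close> at \<open>1\<close>; the conclusion expresses that the second
  derivative of \<open>cos \<theta>\<close> is negative at \<open>1\<close>. With \<open>d = b - a\<close>, the bounds on \<open>a\<close> and \<open>b\<close> give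
  \<open>\<kappa> d (1 + a) \<le> coefg \<kappa> a * coefg \<kappa> b\<close>, so the last assumption and \<open>W\<^sup>2 \<le> 2 E\<close> force
  \<open>d \<ge> 2 a E / (1 + a)\<close>.
\<close>

lemma boundary_sum_bound:
  fixes a b E W \<kappa> :: real
  assumes \<kappa>: "\<kappa> \<in> {0<..<1}" and a: "0 < a" "a < 1" and b: "\<bar>b\<bar> < 1"
    and E: "E \<ge> 1" "W\<^sup>2 \<le> 2 * E"
    and sum: "(b - a) * (1 + W\<^sup>2 * \<kappa> / (coefg \<kappa> b * coefg \<kappa> a)) = 2 * E"
  shows "\<kappa> * a * W\<^sup>2 < (E + a) * (coefg \<kappa> a)\<^sup>2"
proof -
  define G where "G = coefg \<kappa> a"
  define H where "H = coefg \<kappa> b"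
  define d where "d = b - a"
  define X where "X = \<kappa> * d / (G * H)"
  have GH: "\<kappa> \<le> G" "\<kappa> \<le> H"
    using coefg_ge[OF \<kappa>, of a] coefg_ge[OF \<kappa>, of b] a b
    by (auto simp: G_def H_def abs_square_le_1)
  then have pos: "G > 0" "H > 0" using \<kappa> by auto
  have sum': "d * (1 + W\<^sup>2 * \<kappa> / (H * G)) = 2 * E"
    using sum by (simp add: G_def H_def d_def)
  have "1 + W\<^sup>2 * \<kappa> / (H * G) > 0"
    using pos \<kappa> by (simp add: add_pos_nonneg)
  then have d: "d > 0"
    using sum' E by (metis less_le_trans mult_pos_pos zero_less_mult_pos2 zero_less_numeral zero_less_one)
  have d1: "d < 1 - a" using b by (simp add: d_def)
  have "H < G"
    unfolding G_def H_def using d a by (intro coefg_strict_antimono[OF \<kappa>] power_strict_mono) (auto simp: d_def)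
  have X: "2 * E = d + W\<^sup>2 * X"
    using sum' pos by (simp add: X_def field_simps)
  have "X * (1 + a) \<le> 1"
  proof -
    have "\<kappa> * d * (1 + a) \<le> H * (1 - a) * (1 + a)"
      using GH d1 d a \<kappa> by (intro mult_right_mono mult_mono) auto
    also have "\<dots> = H * (1 - a\<^sup>2)"
      by (simp add: algebra_simps power2_eq_square)
    also have "\<dots> \<le> H * G"
      using pos \<kappa> by (intro mult_left_mono) (auto simp: G_def coefg_def mult_left_le_one_le)
    finally show ?thesis
      using pos by (simp add: X_def field_simps)
  qed
  moreover have "W\<^sup>2 * X \<le> 2 * E * X"
    using E d pos \<kappa> by (intro mult_right_mono) (auto simp: X_def)
  then have "2 * E * (1 + a) \<le> (d + 2 * E * X) * (1 + a)"
    using X a by (intro mult_right_mono) auto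
  ultimately have "2 * E * (1 + a) \<le> d * (1 + a) + 2 * E"
    using mult_left_mono[of "X * (1 + a)" 1 "2 * E"] E by (simp add: algebra_simps)
  \<comment> \<open>By \<open>E \<ge> 1\<close>, \<open>1 + a \<le> E + 2 * a\<close>. This
    weakening turns the estimate into one for \<open>2 * E - d\<close>, the quantity that equals
    \<open>W\<^sup>2 * X\<close>.\<close>
  also have "d * (1 + a) \<le> d * (E + 2 * a)"
    using E a d by (intro mult_left_mono) auto
  finally have "a * (2 * E - d) \<le> d * (E + a)"
    by (simp add: algebra_simps)
  \<comment> \<open>Strictness enters through \<open>H < G\<close>; the other factor is positive
    because \<open>d < 1 \<le> E\<close>.\<close>
  moreover have "H * (a * (2 * E - d)) < G * (a * (2 * E - d))"
    using \<open>H < G\<close> a d1 E by (intro mult_strict_right_mono) auto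
  ultimately have "H * (a * (2 * E - d)) < G * (d * (E + a))"
    using pos(1) by (meson less_le_trans mult_left_mono less_imp_le)
  then have "G * (H * (a * (2 * E - d))) < G * (G * (d * (E + a)))"
    using pos(1) by (rule mult_strict_left_mono)
  moreover have "W\<^sup>2 * \<kappa> * d = G * H * (2 * E - d)"
    using X pos by (simp add: X_def field_simps)
  then have "a * (W\<^sup>2 * \<kappa> * d) = a * (G * H * (2 * E - d))" by simp
  then have "d * (\<kappa> * a * W\<^sup>2) = G * (H * (a * (2 * E - d)))"
    by (simp only: mult_ac)
  ultimately have "d * (\<kappa> * a * W\<^sup>2) < d * ((E + a) * G\<^sup>2)"
    by (simp add: algebra_simps power2_eq_square)
  then show ?thesis
    using d by (simp add: G_def)
qed

section \<open>Nonconstant solutions\<close>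

locale nonconstant_solution =
  fixes W E r \<kappa> :: real and \<theta> :: "real \<Rightarrow> real"
  assumes W: "W > 0" and r: "r > 0" and \<kappa>: "\<kappa> \<in> {0<..<1}"
    and sol: "bvp_solution W E r \<kappa> \<theta>"
    and nonconst: "\<not> \<theta> constant_on {0..1}"
begin

abbreviation T where "T \<equiv> deriv01 \<theta>"
abbreviation T2 where "T2 \<equiv> deriv01 (deriv01 \<theta>)"
abbreviation c where "c x \<equiv> cos (\<theta> x)"
abbreviation g where "g x \<equiv> coefg \<kappa> (cos (\<theta> x))"

section \<open>Regularity, and the equation up to the boundary\<close>

lemma smooth: "(deriv01 ^^ n) \<theta> differentiable_on {0..1}"
  using sol by (auto simp: bvp_solution_def smooth01_def)

lemma theta_deriv: "x \<in> {0..1} \<Longrightarrow> (\<theta> has_real_derivative T x) (at x within {0..1})"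
  using deriv01_has_real_derivative smooth[of 0] by simp

lemma T_deriv: "x \<in> {0..1} \<Longrightarrow> (T has_real_derivative T2 x) (at x within {0..1})"
  using deriv01_has_real_derivative smooth[of 1] by simp

lemma cont_T2: "continuous_on {0..1} T2"
  using differentiable_imp_continuous_on[OF smooth[of 2]] by (simp add: numeral_2_eq_2)

lemma cont_T: "continuous_on {0..1} T"
  by (rule DERIV_continuous_on[OF T_deriv])

lemma cont_theta: "continuous_on {0..1} \<theta>"
  by (rule DERIV_continuous_on[OF theta_deriv])

lemma theta_range: "x \<in> {0..1} \<Longrightarrow> \<theta> x \<in> {0..pi}"
  using sol by (auto simp: bvp_solution_def)

lemma kappa_le_g: "\<kappa> \<le> g x"
  using coefg_ge \<kappa> by (simp add: abs_square_le_1)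

lemma g_pos: "g x > 0"
  using kappa_le_g[of x] \<kappa> by simp

lemma c_deriv: "x \<in> {0..1} \<Longrightarrow> (c has_real_derivative - sin (\<theta> x) * T x) (at x within {0..1})"
  by (rule derivative_eq_intros theta_deriv | simp)+

lemma cont_c: "continuous_on {0..1} c"
  by (intro continuous_intros cont_theta)

text \<open>The equation holds on the open interval and extends to its closure by continuity of
  \<open>\<theta>\<close>, \<open>T\<close> and \<open>T2\<close>.\<close>

lemma euler_lagrange_closed:
  assumes "x \<in> {0..1}"
  shows "g x * T2 x = - sin (\<theta> x) * ((1 - \<kappa>) * c x * (T x)\<^sup>2 + r\<^sup>2 * (c x - E))"
proof -
  let ?F = "\<lambda>x. g x * T2 x + sin (\<theta> x) * ((1 - \<kappa>) * c x * (T x)\<^sup>2 + r\<^sup>2 * (c x - E))"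
  have "?F x = 0"
  proof (rule continuous_constant_on_closure[where S = "{0<..<1::real}" and f = ?F])
    show "continuous_on (closure {0<..<1}) ?F"
      unfolding coefg_def by (auto intro!: continuous_intros cont_T cont_T2 cont_theta)
    show "?F y = 0" if "y \<in> {0<..<1}" for y
    proof -
      have "euler_lagrange E r \<kappa> \<theta> y"
        using sol that by (simp add: bvp_solution_def)
      then show ?thesis
        unfolding euler_lagrange_def coefg_cos sin_double by (simp add: field_simps)
    qed
  qed (use assms in simp)
  then show ?thesis by (simp add: algebra_simps)
qed

section \<open>The conserved energy and its boundary values\<close>

lemma boundary: "x \<in> {0, 1} \<Longrightarrow> g x * T x = W * r * sin (\<theta> x)"
  using sol by (auto simp: bvp_solution_def boundary_condition_def coefg_cos)

definition energy :: real where
  "energy = W\<^sup>2 * (1 - (c 0)\<^sup>2) / g 0 - ((c 0)\<^sup>2 - 2 * E * c 0)"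

lemma boundary_square:
  assumes "x \<in> {0, 1}"
  shows "g x * (T x)\<^sup>2 = r\<^sup>2 * (W\<^sup>2 * (1 - (c x)\<^sup>2) / g x)"
proof -
  have "g x * (T x)\<^sup>2 = (g x * T x)\<^sup>2 / g x"
    using g_pos[of x] by (simp add: field_simps power2_eq_square)
  also have "\<dots> = r\<^sup>2 * (W\<^sup>2 * (1 - (c x)\<^sup>2) / g x)"
    unfolding boundary[OF assms] by (simp add: power_mult_distrib sin_squared_eq)
  finally show ?thesis .
qed

text \<open>Multiplying the Euler-Lagrange equation by \<open>2 * T x\<close> makes its left side
  the derivative of \<open>?F\<close>; the boundary condition at \<open>0\<close> identifies the
  constant.\<close>

lemma first_integral:
  assumes "x \<in> {0..1}"
  shows "g x * (T x)\<^sup>2 = r\<^sup>2 * (energy + (c x)\<^sup>2 - 2 * E * c x)"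
proof -
  let ?F = "\<lambda>x. g x * (T x)\<^sup>2 - r\<^sup>2 * ((c x)\<^sup>2 - 2 * E * c x)"
  have "(?F has_real_derivative 0) (at x within {0..1})" if x: "x \<in> {0..1}" for x
  proof -
    let ?D = "2 * (1 - \<kappa>) * c x * sin (\<theta> x) * (T x)^3 + 2 * (g x * T2 x) * T x
      - r\<^sup>2 * (- 2 * c x * sin (\<theta> x) * T x + 2 * E * sin (\<theta> x) * T x)"
    have "(?F has_real_derivative ?D) (at x within {0..1})"
      unfolding coefg_def
      by (rule derivative_eq_intros theta_deriv T_deriv x refl)+
        (simp add: algebra_simps power2_eq_square power3_eq_cube)
    moreover have "?D = 0"
      unfolding euler_lagrange_closed[OF x]
      by (simp add: algebra_simps power2_eq_square power3_eq_cube)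
    ultimately show ?thesis by simp
  qed
  then obtain A where A: "\<And>x. x \<in> {0..1} \<Longrightarrow> ?F x = A"
    using has_field_derivative_zero_constant[of "{0..1::real}" ?F] by auto
  have "A = r\<^sup>2 * energy"
    using A[of 0] boundary_square[of 0] by (simp add: energy_def algebra_simps)
  then show ?thesis
    using A[OF assms] by (simp add: algebra_simps)
qed

lemma energy_boundary:
  assumes "x \<in> {0, 1}"
  shows "energy = W\<^sup>2 * (1 - (c x)\<^sup>2) / g x - ((c x)\<^sup>2 - 2 * E * c x)"
proof -
  have "r\<^sup>2 * (energy + (c x)\<^sup>2 - 2 * E * c x) = r\<^sup>2 * (W\<^sup>2 * (1 - (c x)\<^sup>2) / g x)"
    using boundary_square[OF assms] first_integral[of x] assms by auto
  then have "energy + (c x)\<^sup>2 - 2 * E * c x = W\<^sup>2 * (1 - (c x)\<^sup>2) / g x"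
    using r by (subst (asm) mult_cancel_left) auto
  then show ?thesis by simp
qed

text \<open>
  If \<open>T z = 0\<close> with \<open>cos (\<theta> z) = a\<close> an equilibrium, the first integral factors as
  \<open>(c - a) (c + a - 2 E)\<close>; together with \<open>a = E\<close> or \<open>a\<^sup>2 = 1\<close> this makes the derivative of \<open>c - a\<close>
  bounded by a multiple of \<open>\<bar>c - a\<bar>\<close>.
\<close>

lemma no_equilibrium:
  assumes "z \<in> {0..1}" "T z = 0"
  shows "c z \<noteq> E" "sin (\<theta> z) \<noteq> 0"
proof -
  have "\<not> (c z = E \<or> sin (\<theta> z) = 0)"
  proof
    assume eq: "c z = E \<or> sin (\<theta> z) = 0"
    define a where "a = c z"
    have a: "\<bar>a\<bar> \<le> 1" by (simp add: a_def)
    have aE: "a = E \<or> a\<^sup>2 = 1"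
      using eq sin_cos_squared_add[of "\<theta> z"] by (auto simp: a_def simp del: sin_cos_squared_add)
    have "energy = 2 * E * a - a\<^sup>2"
      using first_integral[OF assms(1)] assms(2) r by (simp add: a_def)
    then have "energy + u\<^sup>2 - 2 * E * u = (u - a) * (u + a - 2 * E)" for u
      by (simp add: algebra_simps power2_eq_square)
    then have T2: "g x * (T x)\<^sup>2 = r\<^sup>2 * ((c x - a) * (c x + a - 2 * E))" if "x \<in> {0..1}" for x
      using first_integral[OF that] by simp
    \<comment> \<open>\<open>M\<close> bounds \<open>\<bar>c x + a - 2 * E\<bar>\<close>, and
      \<open>K\<close> is the constant whose square appears after division by
      \<open>\<kappa>\<close>.\<close>
    define M where "M = 2 + 2 * \<bar>E\<bar>"
    define K where "K = sqrt (2 * M * r\<^sup>2 / \<kappa>)"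
    have bound: "\<bar>sin (\<theta> x) * T x\<bar> \<le> K * \<bar>c x - a\<bar>" if x: "x \<in> {0..1}" for x
    proof -
      have cx: "\<bar>c x\<bar> \<le> 1" by simp
      \<comment> \<open>A second factor \<open>c x - a\<close> is needed. For \<open>a = E\<close>
        it is \<open>c x + a - 2 * E\<close> itself; for \<open>a\<^sup>2 = 1\<close> it comes from
        \<open>1 - (c x)\<^sup>2\<close>.\<close>
      have key: "(1 - (c x)\<^sup>2) * ((c x - a) * (c x + a - 2 * E)) \<le> 2 * M * (c x - a)\<^sup>2"
      proof (cases "a = E")
        case True
        have "1 - (c x)\<^sup>2 \<le> 1" by simp
        also have "1 \<le> 2 * M" by (simp add: M_def)
        finally have "(1 - (c x)\<^sup>2) * (c x - a)\<^sup>2 \<le> 2 * M * (c x - a)\<^sup>2"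
          by (rule mult_right_mono) simp
        then show ?thesis using True by (simp add: power2_eq_square)
      next
        case False
        then have "a\<^sup>2 = 1" using aE by simp
        then have "(1 - (c x)\<^sup>2) * ((c x - a) * (c x + a - 2 * E))
            = (a\<^sup>2 - (c x)\<^sup>2) * ((c x - a) * (c x + a - 2 * E))"
          by simp
        also have "\<dots> = (c x - a)\<^sup>2 * (- (c x + a) * (c x + a - 2 * E))"
          by (simp add: algebra_simps power2_eq_square)
        also have "- (c x + a) * (c x + a - 2 * E) \<le> \<bar>c x + a\<bar> * \<bar>c x + a - 2 * E\<bar>"
          by (metis abs_ge_self abs_minus_cancel abs_mult)
        also have "\<dots> \<le> 2 * M"
        proof (rule mult_mono)
          show "\<bar>c x + a\<bar> \<le> 2" using cx a by linarith
          show "\<bar>c x + a - 2 * E\<bar> \<le> M" using cx a unfolding M_def by linarith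
        qed simp_all
        finally have "(1 - (c x)\<^sup>2) * ((c x - a) * (c x + a - 2 * E)) \<le> (c x - a)\<^sup>2 * (2 * M)"
          by (simp add: mult_left_mono)
        then show ?thesis by (simp only: mult_ac)
      qed
      have "\<kappa> * (sin (\<theta> x) * T x)\<^sup>2 \<le> g x * (sin (\<theta> x) * T x)\<^sup>2"
        using kappa_le_g by (simp add: mult_right_mono)
      also have "\<dots> = (sin (\<theta> x))\<^sup>2 * (g x * (T x)\<^sup>2)"
        by (simp add: power_mult_distrib)
      also have "\<dots> = r\<^sup>2 * ((1 - (c x)\<^sup>2) * ((c x - a) * (c x + a - 2 * E)))"
        unfolding T2[OF x] sin_squared_eq by simp
      also have "\<dots> \<le> r\<^sup>2 * (2 * M * (c x - a)\<^sup>2)"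
        using key by (simp add: mult_left_mono)
      finally have "(sin (\<theta> x) * T x)\<^sup>2 \<le> 2 * M * r\<^sup>2 / \<kappa> * (c x - a)\<^sup>2"
        using \<kappa> by (simp add: field_simps)
      also have "\<dots> = (K * \<bar>c x - a\<bar>)\<^sup>2"
        using \<kappa> by (simp add: K_def M_def power_mult_distrib)
      finally show ?thesis
        using \<kappa> by (intro power2_le_imp_le[of "\<bar>sin (\<theta> x) * T x\<bar>"]) (auto simp: K_def M_def)
    qed
    have "c x - a = 0" if x: "x \<in> {0..1}" for x
    proof (rule gronwall_zero[where f = "\<lambda>x. c x - a" and K = K, OF _ _ assms(1) _ x])
      show "((\<lambda>x. c x - a) has_real_derivative - sin (\<theta> x) * T x) (at x within {0..1})"
        if "x \<in> {0..1}" for x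
        by (rule derivative_eq_intros c_deriv that refl | simp)+
    qed (use bound in \<open>auto simp: a_def\<close>)
    then have "\<theta> x = \<theta> 0" if "x \<in> {0..1}" for x
      using cos_inj_pi[of "\<theta> x" "\<theta> 0"] theta_range[OF that] theta_range[of 0] that by simp
    then have "\<theta> constant_on {0..1}" unfolding constant_on_def by blast
    with nonconst show False by simp
  qed
  then show "c z \<noteq> E" "sin (\<theta> z) \<noteq> 0" by auto
qed

section \<open>Positivity of \<theta>' and strict monotonicity\<close>

lemma sin_nonneg: "x \<in> {0..1} \<Longrightarrow> sin (\<theta> x) \<ge> 0"
  using theta_range[of x] by (auto intro: sin_ge_zero)

text \<open>If the sine vanished at an end, the boundary condition would give \<open>T x = 0\<close>
  there, an equilibrium. So the sine is positive and the boundary condition passes its sign to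
  \<open>T\<close>.\<close>

lemma T_boundary_pos:
  assumes "x \<in> {0, 1}"
  shows "T x > 0"
proof -
  have x: "x \<in> {0..1}" using assms by auto
  have "sin (\<theta> x) \<noteq> 0"
    using no_equilibrium[OF x] boundary[OF assms] g_pos[of x] by auto
  then have "g x * T x > 0"
    using boundary[OF assms] W r sin_nonneg[OF x] by simp
  then show ?thesis using g_pos[of x] by (simp add: zero_less_mult_iff)
qed

lemma T_pos:
  assumes "x \<in> {0..1}"
  shows "T x > 0"
proof (rule ccontr)
  assume "\<not> T x > 0"
  then have "T x \<le> 0" "T 0 > 0" "T 1 > 0" using T_boundary_pos by auto
  obtain y where "y \<in> {0<..1}" and y: "T y = 0" "T2 y \<le> 0"
    by (rule first_zero[OF _ \<open>T 0 > 0\<close> assms \<open>T x \<le> 0\<close>]) (rule T_deriv)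
  moreover obtain z where "z \<in> {0..<1}" and z: "T z = 0" "T2 z \<ge> 0"
    by (rule last_zero[OF _ \<open>T 1 > 0\<close> assms \<open>T x \<le> 0\<close>]) (rule T_deriv)
  ultimately have yz: "y \<in> {0..1}" "z \<in> {0..1}" by auto
  \<comment> \<open>At a zero of \<open>T\<close> the equation reduces to
    \<open>g t * T2 t = - (sin (\<theta> t) * r\<^sup>2 * (c t - E))\<close>.\<close>
  have "c t > E \<longleftrightarrow> T2 t < 0" if "t \<in> {0..1}" "T t = 0" for t
  proof -
    have "sin (\<theta> t) > 0" using no_equilibrium[OF that] sin_nonneg[OF that(1)] by simp
    then have s: "sin (\<theta> t) * r\<^sup>2 > 0" using r by simp
    have "g t * T2 t = - (sin (\<theta> t) * r\<^sup>2 * (c t - E))"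
      using euler_lagrange_closed[OF that(1)] that(2) by simp
    then have "g t * T2 t < 0 \<longleftrightarrow> 0 < sin (\<theta> t) * r\<^sup>2 * (c t - E)" by linarith
    then show ?thesis
      using g_pos[of t] s by (simp only: mult_less_0_iff zero_less_mult_iff) auto
  qed
  moreover have "T2 t \<noteq> 0" if "t \<in> {0..1}" "T t = 0" for t
    using euler_lagrange_closed[OF that(1)] that no_equilibrium[OF that] r by auto
  ultimately have "c y > E" "c z < E"
    using y z yz no_equilibrium(1)[OF yz(2) z(1)] by force+
  moreover have "is_interval (c ` {0..1})"
    using connected_continuous_image[OF cont_c] by (simp add: is_interval_connected_1)
  ultimately have "E \<in> c ` {0..1}"
    using mem_is_interval_1_I[of "c ` {0..1}" "c z" "c y" E] yz by auto
  then obtain t where t: "t \<in> {0..1}" "c t = E" by auto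
  \<comment> \<open>With the energy read off at the zero \<open>y\<close> of \<open>T\<close>, the
    first integral where \<open>c\<close> equals \<open>E\<close> is minus a nonzero square.\<close>
  have "energy = 2 * E * c y - (c y)\<^sup>2"
    using first_integral[OF yz(1)] y(1) r by simp
  then have "energy + E\<^sup>2 - 2 * E * E = - (c y - E)\<^sup>2"
    by (simp add: algebra_simps power2_eq_square)
  then have "g t * (T t)\<^sup>2 = - (r\<^sup>2 * (c y - E)\<^sup>2)"
    using first_integral[OF t(1)] t(2) by simp
  moreover have "r\<^sup>2 * (c y - E)\<^sup>2 > 0" using r \<open>c y > E\<close> by simp
  moreover have "g t * (T t)\<^sup>2 \<ge> 0" using g_pos[of t] by simp
  ultimately show False by linarith
qed

lemma theta_less:
  assumes "0 \<le> x" "x < y" "y \<le> 1"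
  shows "\<theta> x < \<theta> y"
proof (rule DERIV_pos_imp_increasing_open[OF \<open>x < y\<close>])
  fix t assume t: "x < t" "t < y"
  then have "(\<theta> has_real_derivative T t) (at t)"
    using theta_deriv[of t] assms by (simp add: at_within_Icc_at)
  then show "\<exists>d. (\<theta> has_real_derivative d) (at t) \<and> d > 0"
    using T_pos[of t] t assms by auto
qed (use assms continuous_on_subset[OF cont_theta] in auto)

lemma theta_interior:
  assumes "x \<in> {0..1}"
  shows "0 < \<theta> x" "\<theta> x < pi"
proof -
  have "sin (\<theta> t) \<noteq> 0" if "t \<in> {0, 1}" for t
    using T_boundary_pos[OF that] boundary[OF that] g_pos[of t] by auto
  then have "\<theta> 0 \<noteq> 0" "\<theta> 1 \<noteq> pi" by force+
  then have "0 < \<theta> 0" "\<theta> 1 < pi"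
    using theta_range[of 0] theta_range[of 1] by auto
  moreover have "\<theta> 0 \<le> \<theta> x" "\<theta> x \<le> \<theta> 1"
    using theta_less[of 0 x] theta_less[of x 1] assms by force+
  ultimately show "0 < \<theta> x" "\<theta> x < pi" by auto
qed

lemma sin_pos: "x \<in> {0..1} \<Longrightarrow> sin (\<theta> x) > 0"
  using theta_interior sin_gt_zero by blast

lemma abs_c_less_1:
  assumes "x \<in> {0..1}"
  shows "\<bar>c x\<bar> < 1"
proof -
  have "(c x)\<^sup>2 < 1"
    using zero_less_power[OF sin_pos[OF assms], of 2] by (simp add: sin_squared_eq)
  then show ?thesis by (simp add: abs_square_less_1)
qed

lemma c_less:
  assumes "0 \<le> x" "x < y" "y \<le> 1"
  shows "c y < c x"
  using theta_less[OF assms] theta_range[of x] theta_range[of y] assms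
  by (intro cos_monotone_0_pi) auto

lemma kinetic_pos:
  assumes "x \<in> {0..1}"
  shows "energy + (c x)\<^sup>2 - 2 * E * c x > 0"
proof -
  have "g x * (T x)\<^sup>2 > 0"
    using g_pos[of x] T_pos[OF assms] by simp
  then show ?thesis
    unfolding first_integral[OF assms] using r by (simp add: zero_less_mult_iff)
qed

lemma boundary_sum: "(c 0 + c 1) * (1 + W\<^sup>2 * \<kappa> / (g 0 * g 1)) = 2 * E"
proof -
  have "W\<^sup>2 * ((1 - (c 0)\<^sup>2) / g 0 - (1 - (c 1)\<^sup>2) / g 1) = (c 0)\<^sup>2 - (c 1)\<^sup>2 - 2 * E * (c 0 - c 1)"
    using energy_boundary[of 0] energy_boundary[of 1] by (simp add: algebra_simps)
  moreover have "(c 0 - c 1) * ((c 0 + c 1) * (1 + W\<^sup>2 * \<kappa> / (g 0 * g 1)))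
      = (c 0)\<^sup>2 - (c 1)\<^sup>2 - W\<^sup>2 * ((1 - (c 0)\<^sup>2) / g 0 - (1 - (c 1)\<^sup>2) / g 1)"
    unfolding coefg_ratio_diff[OF g_pos g_pos]
    by (simp add: power2_eq_square algebra_simps diff_divide_distrib)
  ultimately have "(c 0 - c 1) * ((c 0 + c 1) * (1 + W\<^sup>2 * \<kappa> / (g 0 * g 1))) = (c 0 - c 1) * (2 * E)"
    by (simp add: algebra_simps)
  then show ?thesis
    using c_less[of 0 1] by (subst (asm) mult_cancel_left) auto
qed

lemma deriv01_deriv01_cos:
  assumes "x \<in> {0..1}"
  shows "deriv01 (deriv01 c) x = - c x * (T x)\<^sup>2 - sin (\<theta> x) * T2 x"
proof -
  have "deriv01 (deriv01 c) x = deriv01 (\<lambda>t. - sin (\<theta> t) * T t) x"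
    by (rule deriv01_cong[OF deriv01_eqI[OF c_deriv] assms])
  also have "\<dots> = - c x * (T x)\<^sup>2 - sin (\<theta> x) * T2 x"
  proof (rule deriv01_eqI[OF _ assms])
    show "((\<lambda>t. - sin (\<theta> t) * T t) has_real_derivative - c x * (T x)\<^sup>2 - sin (\<theta> x) * T2 x)
        (at x within {0..1})"
      by (rule derivative_eq_intros theta_deriv T_deriv assms refl)+
        (simp add: power2_eq_square)
  qed
  finally show ?thesis .
qed

text \<open>The equation eliminates \<open>T2\<close>, and the two terms in
  \<open>(T x)\<^sup>2\<close> combine through
  \<open>g x - (1 - \<kappa>) * (1 - (c x)\<^sup>2) = \<kappa>\<close>.\<close>

lemma g_deriv01_deriv01_cos:
  assumes "x \<in> {0..1}"
  shows "g x * deriv01 (deriv01 c) x = - \<kappa> * c x * (T x)\<^sup>2 - r\<^sup>2 * ((1 - (c x)\<^sup>2) * (E - c x))"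
proof -
  have "g x * deriv01 (deriv01 c) x = - (g x * c x * (T x)\<^sup>2) - sin (\<theta> x) * (g x * T2 x)"
    unfolding deriv01_deriv01_cos[OF assms] by (simp add: algebra_simps)
  also have "\<dots> = - (g x * c x * (T x)\<^sup>2)
      + (sin (\<theta> x))\<^sup>2 * ((1 - \<kappa>) * c x * (T x)\<^sup>2 + r\<^sup>2 * (c x - E))"
    unfolding euler_lagrange_closed[OF assms] by (simp add: algebra_simps power2_eq_square)
  also have "\<dots> = - \<kappa> * c x * (T x)\<^sup>2 - r\<^sup>2 * ((1 - (c x)\<^sup>2) * (E - c x))"
    unfolding sin_squared_eq coefg_def by (simp add: algebra_simps)
  finally show ?thesis .
qed

section \<open>Reflection symmetry for E = 0\<close>

text \<open>The defect \<open>d\<close> vanishes at \<open>0\<close> by \<open>boundary_sum\<close>,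
  and the first integral bounds its derivative by a multiple of \<open>\<bar>d\<bar>\<close>, so
  \<open>gronwall_zero\<close> applies.\<close>

lemma symmetric:
  assumes E: "E = 0" and x: "x \<in> {0..1}"
  shows "\<theta> (1 - x) = pi - \<theta> x"
proof -
  have "1 + W\<^sup>2 * \<kappa> / (g 0 * g 1) > 0"
    using g_pos \<kappa> by (simp add: add_pos_nonneg less_imp_le)
  then have "c 0 = cos (pi - \<theta> 1)"
    using boundary_sum E by auto
  then have ends: "\<theta> 0 = pi - \<theta> 1"
    using theta_range[of 0] theta_range[of 1] cos_inj_pi[of "\<theta> 0" "pi - \<theta> 1"] by auto
  \<comment> \<open>The minimum of \<open>T\<close> is positive, so a bound on the difference of the
    squares of \<open>T x\<close> and \<open>T (1 - x)\<close> yields one on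
    \<open>T x - T (1 - x)\<close>.\<close>
  have "\<exists>z\<in>{0..1}. \<forall>y\<in>{0..1}. T z \<le> T y"
    by (rule continuous_attains_inf[OF _ _ cont_T]) auto
  then obtain z where z: "z \<in> {0..1}" "\<And>y. y \<in> {0..1} \<Longrightarrow> T z \<le> T y"
    by blast
  define M where "M = r\<^sup>2 * \<bar>1 + (1 - \<kappa>) * energy\<bar>"
  define K where "K = M / (\<kappa>\<^sup>2 * T z)"
  define d where "d x = \<theta> x + \<theta> (1 - x) - pi" for x
  have bound: "\<bar>T x - T (1 - x)\<bar> \<le> K * \<bar>d x\<bar>" if x: "x \<in> {0..1}" for x
  proof -
    let ?y = "1 - x"
    have y: "?y \<in> {0..1}" using x by auto
    have "((T x)\<^sup>2 - (T ?y)\<^sup>2) * (g x * g ?y)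
        = g x * (T x)\<^sup>2 * g ?y - g ?y * (T ?y)\<^sup>2 * g x"
      by (simp add: algebra_simps)
    also have "\<dots> = r\<^sup>2 * (1 + (1 - \<kappa>) * energy) * ((c x - c ?y) * (c x + c ?y))"
      unfolding first_integral[OF x] first_integral[OF y] using E
      by (simp add: coefg_def algebra_simps power2_eq_square)
    finally have "\<bar>((T x)\<^sup>2 - (T ?y)\<^sup>2) * (g x * g ?y)\<bar>
        = \<bar>r\<^sup>2 * (1 + (1 - \<kappa>) * energy) * ((c x - c ?y) * (c x + c ?y))\<bar>"
      by (rule arg_cong)
    then have "\<bar>(T x)\<^sup>2 - (T ?y)\<^sup>2\<bar> * (g x * g ?y) = M * (\<bar>c x - c ?y\<bar> * \<bar>c x + c ?y\<bar>)"
      unfolding abs_mult M_def abs_of_pos[OF g_pos] by simp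
    also have "\<dots> \<le> M * (2 * \<bar>d x\<bar>)"
    proof (intro mult_left_mono mult_mono)
      show "\<bar>c x - c ?y\<bar> \<le> 2"
        using abs_cos_le_one[of "\<theta> x"] abs_cos_le_one[of "\<theta> ?y"] by linarith
      \<comment> \<open>The sum is \<open>cos (\<theta> x) - cos (pi - \<theta> ?y)\<close>, and the
        two arguments differ by \<open>d x\<close>.\<close>
      show "\<bar>c x + c ?y\<bar> \<le> \<bar>d x\<bar>"
        using abs_cos_diff_le[of "\<theta> x" "pi - \<theta> ?y"] by (simp add: d_def algebra_simps)
    qed (auto simp: M_def)
    finally have 1: "\<bar>(T x)\<^sup>2 - (T ?y)\<^sup>2\<bar> * (g x * g ?y) \<le> M * (2 * \<bar>d x\<bar>)" .
    have "\<bar>T x - T ?y\<bar> * (2 * T z) * \<kappa>\<^sup>2 \<le> \<bar>T x - T ?y\<bar> * (T x + T ?y) * (g x * g ?y)"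
      unfolding power2_eq_square
      using z(2)[OF x] z(2)[OF y] T_pos[OF x] T_pos[OF y] T_pos[OF z(1)] kappa_le_g g_pos[of x] \<kappa>
      by (intro mult_mono) auto
    also have "\<bar>T x - T ?y\<bar> * (T x + T ?y) = \<bar>(T x)\<^sup>2 - (T ?y)\<^sup>2\<bar>"
      using T_pos[OF x] T_pos[OF y] by (simp add: square_diff_square_factored power2_eq_square abs_mult)
    finally have "\<bar>T x - T ?y\<bar> * (2 * T z) * \<kappa>\<^sup>2 \<le> M * (2 * \<bar>d x\<bar>)"
      using 1 by linarith
    then show ?thesis
      using T_pos[OF z(1)] \<kappa> by (simp add: K_def field_simps)
  qed
  have "d x = 0"
  proof (rule gronwall_zero[where f = d and K = K, OF _ bound _ _ x])
    show "(d has_real_derivative T x - T (1 - x)) (at x within {0..1})" if x: "x \<in> {0..1}" for x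
    proof -
      have "(-) 1 ` {0..1::real} = {0..1}"
        by (simp add: image_diff_atLeastAtMost)
      then have "(\<theta> has_real_derivative T (1 - x)) (at (1 - x) within (-) 1 ` {0..1})"
        using theta_deriv[of "1 - x"] x by auto
      then have "(\<theta> \<circ> (-) 1 has_real_derivative T (1 - x) * -1) (at x within {0..1})"
        by (rule DERIV_image_chain) (auto intro!: derivative_eq_intros)
      then have *: "((\<lambda>x. \<theta> (1 - x)) has_real_derivative - T (1 - x)) (at x within {0..1})"
        by (simp add: o_def)
      show ?thesis
        unfolding d_def by (rule derivative_eq_intros theta_deriv * x refl | simp)+
    qed
    show "d 0 = 0" using ends by (simp add: d_def)
  qed auto
  then show ?thesis by (simp add: d_def)
qed

section \<open>Concavity of cos \<theta> for large E\<close>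

text \<open>For \<open>c x \<ge> 0\<close> the sign is clear from \<open>c x < 1 \<le> E\<close>.
  For \<open>c x < 0\<close> the term in \<open>(T x)\<^sup>2\<close> has the wrong sign; the energy
  at \<open>1\<close> bounds it, and \<open>boundary_sum_bound\<close> is carried from
  \<open>1\<close> to \<open>x\<close>.\<close>

lemma deriv01_deriv01_cos_neg:
  assumes E: "E \<ge> 1" "W\<^sup>2 \<le> 2 * E" and x: "x \<in> {0..1}"
  shows "deriv01 (deriv01 c) x < 0"
proof -
  have "0 < \<kappa> * c x * (T x)\<^sup>2 + r\<^sup>2 * ((1 - (c x)\<^sup>2) * (E - c x))"
  proof (cases "c x \<ge> 0")
    case True
    have "0 < r\<^sup>2 * ((1 - (c x)\<^sup>2) * (E - c x))"
      using abs_c_less_1[OF x] E r by (simp add: abs_square_less_1)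
    moreover have "0 \<le> \<kappa> * c x * (T x)\<^sup>2" using True \<kappa> by simp
    ultimately show ?thesis by linarith
  next
    case False
    define a where "a = - c 1"
    define u where "u = - c x"
    have u: "0 < u" "u \<le> a"
      using False c_less[of x 1] x by (force simp: u_def a_def)+
    have a: "0 < a" "a < 1" using u abs_c_less_1[of 1] by (auto simp: a_def)
    have g1: "g 1 = coefg \<kappa> a" and gx: "g x = coefg \<kappa> u" by (simp_all add: a_def u_def coefg_def)
    have u2: "u\<^sup>2 \<le> a\<^sup>2" using u by (simp add: power_mono)
    have u1: "u\<^sup>2 < 1" using u a by (simp add: abs_square_less_1)
    have g1_le: "g 1 \<le> g x"
      unfolding g1 gx unfolding coefg_def using u2 \<kappa> by (simp add: mult_left_mono)
    have "(c 0 - a) * (1 + W\<^sup>2 * \<kappa> / (coefg \<kappa> (c 0) * coefg \<kappa> a)) = 2 * E"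
      using boundary_sum by (simp add: a_def coefg_def)
    then have key: "\<kappa> * a * W\<^sup>2 < (E + a) * (g 1)\<^sup>2"
      unfolding g1 using abs_c_less_1[of 0] by (intro boundary_sum_bound[OF \<kappa> a _ E]) auto
    \<comment> \<open>Since \<open>u / (E + u)\<close> increases with \<open>u\<close>, the
      inequality at \<open>a\<close> passes to \<open>u\<close>.\<close>
    have "\<kappa> * u * W\<^sup>2 * (E + a) \<le> \<kappa> * a * W\<^sup>2 * (E + u)"
      using u E \<kappa> mult_left_mono[of "u * E" "a * E" "\<kappa> * W\<^sup>2"] by (simp add: algebra_simps)
    also have "\<dots> < (E + a) * (g 1)\<^sup>2 * (E + u)"
      using key u E by (intro mult_strict_right_mono) auto
    finally have "\<kappa> * u * W\<^sup>2 * (E + a) < (g 1)\<^sup>2 * (E + u) * (E + a)"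
      by (simp add: algebra_simps)
    then have "\<kappa> * u * W\<^sup>2 < (g 1)\<^sup>2 * (E + u)"
      using a E by simp
    also have "\<dots> \<le> (g x)\<^sup>2 * (E + u)"
      using g1_le g_pos[of 1] u E by (intro mult_right_mono power_mono) auto
    finally have key2: "\<kappa> * u * W\<^sup>2 < (g x)\<^sup>2 * (E + u)" .
    have "energy + (c x)\<^sup>2 - 2 * E * c x
        = W\<^sup>2 * ((1 - (c 1)\<^sup>2) / g 1) + (u\<^sup>2 - a\<^sup>2) - 2 * E * (a - u)"
      using energy_boundary[of 1] by (simp add: a_def u_def algebra_simps)
    also have "\<dots> \<le> W\<^sup>2 * ((1 - (c 1)\<^sup>2) / g 1)"
    proof -
      have "0 \<le> 2 * E * (a - u)" using u E by simp
      then show ?thesis using u2 by linarith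
    qed
    also have "\<dots> \<le> W\<^sup>2 * ((1 - (c x)\<^sup>2) / g x)"
    proof (intro mult_left_mono)
      have "(1 - (c x)\<^sup>2) / g x - (1 - (c 1)\<^sup>2) / g 1 \<ge> 0"
        unfolding coefg_ratio_diff[OF g_pos g_pos] using \<kappa> g_pos[of x] g_pos[of 1] u2
        by (simp add: a_def u_def)
      then show "(1 - (c 1)\<^sup>2) / g 1 \<le> (1 - (c x)\<^sup>2) / g x" by simp
    qed simp
    finally have "g x * (T x)\<^sup>2 \<le> r\<^sup>2 * (W\<^sup>2 * ((1 - (c x)\<^sup>2) / g x))"
      unfolding first_integral[OF x] by (rule mult_left_mono) simp
    then have T_le: "(g x)\<^sup>2 * (T x)\<^sup>2 \<le> r\<^sup>2 * W\<^sup>2 * (1 - u\<^sup>2)"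
      using g_pos[of x] by (simp add: field_simps power2_eq_square u_def)
    have "(g x)\<^sup>2 * (\<kappa> * u * (T x)\<^sup>2) \<le> \<kappa> * u * (r\<^sup>2 * W\<^sup>2 * (1 - u\<^sup>2))"
      using mult_left_mono[OF T_le, of "\<kappa> * u"] \<kappa> u by (simp add: algebra_simps)
    also have "\<dots> = (r\<^sup>2 * (1 - u\<^sup>2)) * (\<kappa> * u * W\<^sup>2)" by (simp add: algebra_simps)
    also have "\<dots> < (r\<^sup>2 * (1 - u\<^sup>2)) * ((g x)\<^sup>2 * (E + u))"
      using key2 r u1 by (intro mult_strict_left_mono) auto
    finally have "(g x)\<^sup>2 * (\<kappa> * u * (T x)\<^sup>2) < (g x)\<^sup>2 * (r\<^sup>2 * ((1 - u\<^sup>2) * (E + u)))"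
      by (simp add: algebra_simps)
    then have "\<kappa> * u * (T x)\<^sup>2 < r\<^sup>2 * ((1 - u\<^sup>2) * (E + u))"
      using g_pos[of x] by simp
    then show ?thesis by (simp add: u_def)
  qed
  then have "g x * deriv01 (deriv01 c) x < 0"
    unfolding g_deriv01_deriv01_cos[OF x] by simp
  then show ?thesis using g_pos[of x] by (simp add: mult_less_0_iff)
qed

section \<open>The inflection point of \<theta>\<close>

text \<open>Up to the positive factor \<open>r\<^sup>2 * sin (\<theta> x) / (g x)\<^sup>2\<close>,
  this is \<open>- T2 x\<close> as a function of \<open>c x\<close>, after the first integral has
  removed \<open>(T x)\<^sup>2\<close>.\<close>

definition inflection :: "real \<Rightarrow> real" where
  "inflection v = ((1 - \<kappa>) * energy + 1) * v - (1 - \<kappa>) * E * v\<^sup>2 - E"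

text \<open>The cubic terms cancel, which is why \<open>inflection\<close> is only quadratic.\<close>

lemma inflection_alt:
  "inflection v = (1 - \<kappa>) * v * (energy + v\<^sup>2 - 2 * E * v) + (v - E) * coefg \<kappa> v"
  by (simp add: inflection_def coefg_def algebra_simps power2_eq_square)

lemma T2_inflection:
  assumes "x \<in> {0..1}"
  shows "(g x)\<^sup>2 * T2 x = - (r\<^sup>2 * sin (\<theta> x)) * inflection (c x)"
proof -
  have "(g x)\<^sup>2 * T2 x = g x * (g x * T2 x)" by (simp add: power2_eq_square)
  also have "\<dots> = - sin (\<theta> x) * ((1 - \<kappa>) * c x * (g x * (T x)\<^sup>2) + r\<^sup>2 * (c x - E) * g x)"
    unfolding euler_lagrange_closed[OF assms] by (simp add: algebra_simps)
  also have "\<dots> = - (r\<^sup>2 * sin (\<theta> x)) * inflection (c x)"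
    unfolding first_integral[OF assms] inflection_alt by (simp add: algebra_simps)
  finally show ?thesis .
qed

lemma T2_sign:
  assumes "x \<in> {0..1}"
  shows "T2 x > 0 \<longleftrightarrow> inflection (c x) < 0" "T2 x < 0 \<longleftrightarrow> inflection (c x) > 0"
proof -
  have s: "0 < r\<^sup>2 * sin (\<theta> x)" "0 < (g x)\<^sup>2"
    using r sin_pos[OF assms] g_pos[of x] by auto
  have "T2 x > 0 \<longleftrightarrow> (g x)\<^sup>2 * T2 x > 0" "T2 x < 0 \<longleftrightarrow> (g x)\<^sup>2 * T2 x < 0"
    using s(2) by (simp_all add: zero_less_mult_iff mult_less_0_iff)
  then show "T2 x > 0 \<longleftrightarrow> inflection (c x) < 0" "T2 x < 0 \<longleftrightarrow> inflection (c x) > 0"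
    unfolding T2_inflection[OF assms] using s(1)
    by (auto simp: zero_less_mult_iff mult_less_0_iff)
qed

text \<open>In \<open>inflection_alt\<close> the energy factor is positive along the solution, so
  the summands take their signs from \<open>c x\<close> and \<open>c x - E\<close>.\<close>

lemma inflection_pos:
  assumes "x \<in> {0..1}" "c x \<ge> E" "c x > 0"
  shows "inflection (c x) > 0"
  unfolding inflection_alt using kinetic_pos[OF assms(1)] g_pos[of x] assms \<kappa>
  by (intro add_pos_nonneg) auto

lemma inflection_neg:
  assumes "x \<in> {0..1}" "c x < E" "c x \<le> 0"
  shows "inflection (c x) < 0"
proof -
  have "(1 - \<kappa>) * c x * (energy + (c x)\<^sup>2 - 2 * E * c x) \<le> 0"
    using kinetic_pos[OF assms(1)] assms \<kappa> by (intro mult_nonpos_nonneg mult_nonneg_nonpos) auto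
  moreover have "(c x - E) * g x < 0"
    using assms g_pos[of x] by (simp add: mult_neg_pos)
  ultimately show ?thesis unfolding inflection_alt by linarith
qed

text \<open>Above \<open>E\<close> the claim is \<open>inflection_pos\<close>. Below, concavity
  interpolates between \<open>c x\<close> and \<open>E\<close>; the point \<open>t\<close> makes the
  first integral available at the value \<open>E\<close>, where \<open>inflection\<close> is then
  positive.\<close>

lemma inflection_single_crossing:
  assumes E: "E \<ge> 0" and t: "t \<in> {0..1}" "c t = E"
    and x: "x \<in> {0..1}" and y: "y \<in> {0..1}"
    and less: "c x < c y" and nonneg: "inflection (c x) \<ge> 0"
  shows "inflection (c y) > 0"
proof (cases "c y \<ge> E \<and> c y > 0")
  case True
  then show ?thesis using inflection_pos[OF y] by simp
next
  case False
  have "\<not> (c x < E \<and> c x \<le> 0)" using inflection_neg[OF x] nonneg by force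
  with False less E have *: "0 < c x" "c y < E" by auto
  have "inflection E > 0"
    using inflection_pos[OF t(1)] t(2) * less by simp
  then have "(c y - c x) * inflection E > 0" using less by simp
  moreover have "(E - c y) * inflection (c x) \<ge> 0" using * nonneg by simp
  moreover have "(1 - \<kappa>) * E * ((c y - c x) * (E - c y) * (E - c x)) \<ge> 0"
    using less * \<kappa> E by simp
  \<comment> \<open>This is linear interpolation between \<open>c x\<close> and \<open>E\<close>;
    the last term is the exact remainder of the quadratic.\<close>
  moreover have "(E - c x) * inflection (c y) = (E - c y) * inflection (c x)
      + (c y - c x) * inflection E + (1 - \<kappa>) * E * ((c y - c x) * (E - c y) * (E - c x))"
    by (simp add: inflection_def algebra_simps power2_eq_square)
  ultimately have "(E - c x) * inflection (c y) > 0" by linarith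
  then show ?thesis using * less by (simp add: zero_less_mult_iff)
qed

text \<open>\<open>inflection (c x)\<close> changes sign between the ends, which gives
  \<open>z\<close>. As \<open>c\<close> decreases, single crossing fixes the sign on either side of
  \<open>z\<close>.\<close>

lemma unique_inflection:
  assumes E: "E \<ge> 0" and c0: "c 0 \<ge> E" and c1: "c 1 \<le> 0"
  obtains z where "z \<in> {0<..<1}" "T2 z = 0"
    "\<And>x. x \<in> {z<..<1} \<Longrightarrow> T2 x > 0" "\<And>x. x \<in> {0<..<z} \<Longrightarrow> T2 x < 0"
proof -
  have "1 + W\<^sup>2 * \<kappa> / (g 0 * g 1) > 0"
    using g_pos \<kappa> by (simp add: add_pos_nonneg less_imp_le)
  \<comment> \<open>For \<open>E = 0\<close> the hypotheses on the ends are not strict; here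
    \<open>c 0 = - c 1\<close> and monotonicity make them so.\<close>
  then have "E = 0 \<Longrightarrow> c 0 + c 1 = 0"
    using boundary_sum by auto
  moreover have "c 1 < c 0" using c_less[of 0 1] by simp
  ultimately have ends: "c 0 > 0" "c 1 < E" using E c0 c1 by linarith+
  then have pos: "inflection (c 0) > 0" and neg: "inflection (c 1) < 0"
    using inflection_pos[of 0] inflection_neg[of 1] c0 c1 by auto
  have "continuous_on {0..1} (\<lambda>x. inflection (c x))"
    unfolding inflection_def by (intro continuous_intros cont_theta)
  then obtain z where z: "0 \<le> z" "z \<le> 1" "inflection (c z) = 0"
    using IVT2'[of "\<lambda>x. inflection (c x)" 1 0 0] pos neg by auto
  obtain t where t: "t \<in> {0..1}" "c t = E"
    using IVT2'[of c 1 E 0] cont_c ends c0 by auto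
  have "z \<noteq> 0" "z \<noteq> 1" using z pos neg by auto
  with z have z01: "z \<in> {0<..<1}" by auto
  show ?thesis
  proof (rule that[OF z01])
    have "(g z)\<^sup>2 * T2 z = 0" using T2_inflection[of z] z by simp
    then show "T2 z = 0" using g_pos[of z] by simp
  next
    fix x assume x: "x \<in> {z<..<1}"
    have "inflection (c x) < 0"
      using inflection_single_crossing[OF E t, of x z] c_less[of z x] x z by force
    then show "T2 x > 0" using T2_sign[of x] x z by simp
  next
    fix x assume x: "x \<in> {0<..<z}"
    have "inflection (c x) > 0"
      using inflection_single_crossing[OF E t, of z x] c_less[of x z] x z by force
    then show "T2 x < 0" using T2_sign[of x] x z by simp
  qed
qed

end

section \<open>Comparison of two solutions for E = 0\<close>

lemma theta_mid:
  assumes "nonconstant_solution W 0 r \<kappa> \<theta>"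
  shows "\<theta> (1 / 2) = pi / 2"
  using nonconstant_solution.symmetric[OF assms, of "1 / 2"] by simp

text \<open>Both angles equal \<open>pi / 2\<close> at the midpoint. Wherever they meet,
  \<open>g\<close> and \<open>c\<close> agree, so the first integral gives the larger slope to the
  larger energy.\<close>

lemma energy_comparison:
  assumes 1: "nonconstant_solution W 0 r \<kappa> \<theta>\<^sub>1"
    and 2: "nonconstant_solution W 0 r \<kappa> \<theta>\<^sub>2"
    and less: "nonconstant_solution.energy W 0 \<kappa> \<theta>\<^sub>2 < nonconstant_solution.energy W 0 \<kappa> \<theta>\<^sub>1"
    and x: "x \<in> {1 / 2<..1}"
  shows "\<theta>\<^sub>2 x < \<theta>\<^sub>1 x"
proof -
  interpret s1: nonconstant_solution W 0 r \<kappa> \<theta>\<^sub>1 by (rule 1)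
  interpret s2: nonconstant_solution W 0 r \<kappa> \<theta>\<^sub>2 by (rule 2)
  have "\<theta>\<^sub>1 x - \<theta>\<^sub>2 x > 0"
  proof (rule positive_if_increasing_at_zeros[of "1 / 2" 1 "\<lambda>x. \<theta>\<^sub>1 x - \<theta>\<^sub>2 x" "\<lambda>x. s1.T x - s2.T x"])
    fix x :: real assume x: "x \<in> {1 / 2..1}"
    then have x': "x \<in> {0..1}" by auto
    have "((\<lambda>x. \<theta>\<^sub>1 x - \<theta>\<^sub>2 x) has_real_derivative s1.T x - s2.T x) (at x within {0..1})"
      by (intro derivative_intros s1.theta_deriv s2.theta_deriv x')
    then show "((\<lambda>x. \<theta>\<^sub>1 x - \<theta>\<^sub>2 x) has_real_derivative s1.T x - s2.T x) (at x within {1 / 2..1})"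
      by (rule DERIV_subset) auto
    assume "\<theta>\<^sub>1 x - \<theta>\<^sub>2 x = 0"
    then have eq: "\<theta>\<^sub>1 x = \<theta>\<^sub>2 x" by simp
    have "r\<^sup>2 * (s2.energy + (s1.c x)\<^sup>2) < r\<^sup>2 * (s1.energy + (s1.c x)\<^sup>2)"
      using less s1.r by simp
    then have "s1.g x * (s2.T x)\<^sup>2 < s1.g x * (s1.T x)\<^sup>2"
      using s1.first_integral[OF x'] s2.first_integral[OF x'] eq by simp
    then have "s2.T x < s1.T x"
      using s1.g_pos[of x] s1.T_pos[OF x'] by (auto dest: power2_less_imp_less)
    then show "s1.T x - s2.T x > 0" by simp
  qed (use x theta_mid[OF 1] theta_mid[OF 2] in auto)
  then show ?thesis by simp
qed

text \<open>On the right half both cosines are negative and the larger angle has the larger square;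
  reflection gives the left half.\<close>

lemma cos_square_comparison:
  assumes 1: "nonconstant_solution W 0 r \<kappa> \<theta>\<^sub>1"
    and 2: "nonconstant_solution W 0 r \<kappa> \<theta>\<^sub>2"
    and less: "nonconstant_solution.energy W 0 \<kappa> \<theta>\<^sub>2 < nonconstant_solution.energy W 0 \<kappa> \<theta>\<^sub>1"
    and x: "x \<in> {0..1} - {1 / 2}"
  shows "(cos (\<theta>\<^sub>2 x))\<^sup>2 < (cos (\<theta>\<^sub>1 x))\<^sup>2"
proof -
  interpret s1: nonconstant_solution W 0 r \<kappa> \<theta>\<^sub>1 by (rule 1)
  interpret s2: nonconstant_solution W 0 r \<kappa> \<theta>\<^sub>2 by (rule 2)
  have right: "(cos (\<theta>\<^sub>2 x))\<^sup>2 < (cos (\<theta>\<^sub>1 x))\<^sup>2" if x: "x \<in> {1 / 2<..1}" for x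
  proof -
    have "s2.c x < s2.c (1 / 2)" using x by (intro s2.c_less) auto
    then have "s2.c x < 0" using theta_mid[OF 2] by simp
    moreover have "s1.c x < s2.c x"
      using energy_comparison[OF 1 2 less x] s1.theta_range[of x] s2.theta_range[of x] x
      by (intro cos_monotone_0_pi) auto
    ultimately have "(- s2.c x)\<^sup>2 < (- s1.c x)\<^sup>2"
      by (intro power_strict_mono) auto
    then show ?thesis by simp
  qed
  show ?thesis
  proof (cases "x > 1 / 2")
    case True
    then show ?thesis using right x by simp
  next
    case False
    then have "(cos (\<theta>\<^sub>2 (1 - x)))\<^sup>2 < (cos (\<theta>\<^sub>1 (1 - x)))\<^sup>2"
      using right[of "1 - x"] x by force
    then show ?thesis
      using s1.symmetric[of x] s2.symmetric[of x] x by simp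
  qed
qed

theorem theorem2p5:
  fixes W E r \<kappa> :: real and \<theta> p :: "real \<Rightarrow> real"
  assumes W: "W > 0" and E: "E \<ge> 0" and r: "r \<ge> 1" and \<kappa>: "\<kappa> \<in> {0<..<1}"
    and sol: "bvp_solution W E r \<kappa> \<theta>"
    and nonconst: "\<not> \<theta> constant_on {0..1}"
    and p: "p = (\<lambda>x. cos (\<theta> x))"
  shows
    "(\<forall>x\<in>{0..1}. deriv01 \<theta> x > 0) \<and>
     (E = 0 \<longrightarrow>
        (\<forall>x\<in>{0..1}. cos (\<theta> x) = - cos (\<theta> (1 - x))) \<and>
        cos (\<theta> (1 / 2)) = 0 \<and>
        (\<forall>x\<in>{0..1} - {1 / 2}. cos (\<theta> x) \<noteq> 0) \<and>
        (\<forall>\<theta>\<^sub>1 \<theta>\<^sub>2 C\<^sub>1 C\<^sub>2.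
           bvp_solution W E r \<kappa> \<theta>\<^sub>1 \<longrightarrow> \<not> \<theta>\<^sub>1 constant_on {0..1} \<longrightarrow>
           bvp_solution W E r \<kappa> \<theta>\<^sub>2 \<longrightarrow> \<not> \<theta>\<^sub>2 constant_on {0..1} \<longrightarrow>
           (\<forall>x\<in>{0, 1}.
              W\<^sup>2 * (sin (\<theta>\<^sub>1 x))\<^sup>2 / ((sin (\<theta>\<^sub>1 x))\<^sup>2 + \<kappa> * (cos (\<theta>\<^sub>1 x))\<^sup>2)
              - ((cos (\<theta>\<^sub>1 x))\<^sup>2 - 2 * E * cos (\<theta>\<^sub>1 x)) = C\<^sub>1) \<longrightarrow>
           (\<forall>x\<in>{0, 1}.
              W\<^sup>2 * (sin (\<theta>\<^sub>2 x))\<^sup>2 / ((sin (\<theta>\<^sub>2 x))\<^sup>2 + \<kappa> * (cos (\<theta>\<^sub>2 x))\<^sup>2)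
              - ((cos (\<theta>\<^sub>2 x))\<^sup>2 - 2 * E * cos (\<theta>\<^sub>2 x)) = C\<^sub>2) \<longrightarrow>
           C\<^sub>1 > C\<^sub>2 \<longrightarrow>
           (\<forall>x\<in>{0..1} - {1 / 2}. (cos (\<theta>\<^sub>1 x))\<^sup>2 > (cos (\<theta>\<^sub>2 x))\<^sup>2))) \<and>
     (E \<ge> max 1 (W\<^sup>2 * (sqrt (\<kappa> + 2 + sqrt (\<kappa>\<^sup>2 + 8 * \<kappa>)) / (2 * sqrt 2))) \<longrightarrow>
        (\<forall>x\<in>{0..1}. deriv01 (deriv01 p) x < 0)) \<and>
     (p 0 \<ge> E \<longrightarrow> p 1 \<le> 0 \<longrightarrow>
        (\<exists>x\<^sub>0. x\<^sub>0 \<in> {0<..<1} \<and> deriv01 (deriv01 \<theta>) x\<^sub>0 = 0 \<and>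
             (\<forall>y\<in>{0<..<1}. deriv01 (deriv01 \<theta>) y = 0 \<longrightarrow> y = x\<^sub>0) \<and>
             (\<forall>x\<in>{x\<^sub>0<..<1}. deriv01 (deriv01 \<theta>) x > 0) \<and>
             (\<forall>x\<in>{0<..<x\<^sub>0}. deriv01 (deriv01 \<theta>) x < 0)))"
proof (intro conjI impI ballI allI)
  interpret nonconstant_solution W E r \<kappa> \<theta>
    using assms by unfold_locales auto
  show "deriv01 \<theta> x > 0" if "x \<in> {0..1}" for x
    using T_pos that .
  {
    assume E0: "E = 0"
    show sym: "cos (\<theta> x) = - cos (\<theta> (1 - x))" if "x \<in> {0..1}" for x
      using symmetric[OF E0 that] by simp
    show mid: "cos (\<theta> (1 / 2)) = 0"
      using sym[of "1 / 2"] by simp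
    show "cos (\<theta> x) \<noteq> 0" if "x \<in> {0..1} - {1 / 2}" for x
      using c_less[of x "1 / 2"] c_less[of "1 / 2" x] mid that by (cases "x < 1 / 2") auto
    fix \<theta>\<^sub>1 \<theta>\<^sub>2 :: "real \<Rightarrow> real" and C\<^sub>1 C\<^sub>2 x :: real
    assume 1: "bvp_solution W E r \<kappa> \<theta>\<^sub>1" "\<not> \<theta>\<^sub>1 constant_on {0..1}"
      and 2: "bvp_solution W E r \<kappa> \<theta>\<^sub>2" "\<not> \<theta>\<^sub>2 constant_on {0..1}"
      and C1: "\<forall>x\<in>{0, 1}.
              W\<^sup>2 * (sin (\<theta>\<^sub>1 x))\<^sup>2 / ((sin (\<theta>\<^sub>1 x))\<^sup>2 + \<kappa> * (cos (\<theta>\<^sub>1 x))\<^sup>2)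
              - ((cos (\<theta>\<^sub>1 x))\<^sup>2 - 2 * E * cos (\<theta>\<^sub>1 x)) = C\<^sub>1"
      and C2: "\<forall>x\<in>{0, 1}.
              W\<^sup>2 * (sin (\<theta>\<^sub>2 x))\<^sup>2 / ((sin (\<theta>\<^sub>2 x))\<^sup>2 + \<kappa> * (cos (\<theta>\<^sub>2 x))\<^sup>2)
              - ((cos (\<theta>\<^sub>2 x))\<^sup>2 - 2 * E * cos (\<theta>\<^sub>2 x)) = C\<^sub>2"
      and C: "C\<^sub>1 > C\<^sub>2" and x: "x \<in> {0..1} - {1 / 2}"
    interpret s1: nonconstant_solution W 0 r \<kappa> \<theta>\<^sub>1
      using W r \<kappa> 1 E0 by unfold_locales auto
    interpret s2: nonconstant_solution W 0 r \<kappa> \<theta>\<^sub>2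
      using W r \<kappa> 2 E0 by unfold_locales auto
    \<comment> \<open>The condition at \<open>x = 0\<close> is the definition of the energy.\<close>
    have "s1.energy = C\<^sub>1" "s2.energy = C\<^sub>2"
      using C1 C2 E0 unfolding coefg_cos
      by (simp_all add: s1.energy_def s2.energy_def sin_squared_eq)
    with C show "(cos (\<theta>\<^sub>1 x))\<^sup>2 > (cos (\<theta>\<^sub>2 x))\<^sup>2"
      by (intro cos_square_comparison[OF s1.nonconstant_solution_axioms s2.nonconstant_solution_axioms _ x])
        simp
  }
  show "deriv01 (deriv01 p) x < 0"
    if bound: "E \<ge> max 1 (W\<^sup>2 * (sqrt (\<kappa> + 2 + sqrt (\<kappa>\<^sup>2 + 8 * \<kappa>)) / (2 * sqrt 2)))"
      and x: "x \<in> {0..1}" for x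
  proof -
    \<comment> \<open>The outer radicand is at least \<open>2\<close>, so the factor of
      \<open>W\<^sup>2\<close> in the threshold is at least \<open>1 / 2\<close> and
      \<open>W\<^sup>2 \<le> 2 * E\<close> follows.\<close>
    have "sqrt 2 \<le> sqrt (\<kappa> + 2 + sqrt (\<kappa>\<^sup>2 + 8 * \<kappa>))"
      using \<kappa> by simp
    then have "1 / 2 \<le> sqrt (\<kappa> + 2 + sqrt (\<kappa>\<^sup>2 + 8 * \<kappa>)) / (2 * sqrt 2)"
      by (simp add: field_simps)
    then have "W\<^sup>2 * (1 / 2) \<le> W\<^sup>2 * (sqrt (\<kappa> + 2 + sqrt (\<kappa>\<^sup>2 + 8 * \<kappa>)) / (2 * sqrt 2))"
      by (rule mult_left_mono) simp
    with bound have "E \<ge> 1" "W\<^sup>2 \<le> 2 * E" by auto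
    then show ?thesis
      unfolding p using x by (rule deriv01_deriv01_cos_neg)
  qed
  assume "p 0 \<ge> E" "p 1 \<le> 0"
  then obtain z where z: "z \<in> {0<..<1}" "T2 z = 0"
    "\<And>x. x \<in> {z<..<1} \<Longrightarrow> T2 x > 0" "\<And>x. x \<in> {0<..<z} \<Longrightarrow> T2 x < 0"
    using unique_inflection[OF E] by (auto simp: p)
  have "y = z" if "y \<in> {0<..<1}" "T2 y = 0" for y
    using z(3)[of y] z(4)[of y] that by (cases y z rule: linorder_cases) auto
  with z show "\<exists>x\<^sub>0. x\<^sub>0 \<in> {0<..<1} \<and> T2 x\<^sub>0 = 0 \<and> (\<forall>y\<in>{0<..<1}. T2 y = 0 \<longrightarrow> y = x\<^sub>0) \<and>
      (\<forall>x\<in>{x\<^sub>0<..<1}. T2 x > 0) \<and> (\<forall>x\<in>{0<..<x\<^sub>0}. T2 x < 0)"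
    by blast
qed

end
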